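(* Let $M=(S,A,P,R,\gamma,\rho)$ be a Markov decision process with finite state space $S$ and discount factor $\gamma\in[0,1)$, let $\lambda\in[0,1)$, let $\pi$ be a target policy with value function $V^\pi$ and $\mu$ a behavior policy, let $d_\mu$ be the stationary distribution over states induced by $\mu$, and let $i:S\to\mathbb{R}^+$ be a given function. Put $\mathbf{i}(s)=i(s)\,d_\mu(s)$, $$P^\lambda_\pi = I-(I-\gamma\lambda P_\pi)^{-1}(I-\gamma P_\pi),\qquad m^\top=\mathbf{i}^\top (I-P^\lambda_\pi)^{-1},$$ where $m>0$ element-wise, and $$T^{(\lambda)}v=(I-\gamma\lambda P_\pi)^{-1}R_\pi+P^\lambda_\pi v .$$ Let $\Pi_m$ be the projection onto the linear subspace of $\mathbb{R}^{|S|}$ spanned by the features, with respect to the $m$-weighted Euclidean norm, and let $\theta^*\in\mathbb{R}^n$ be a solution of the projected fixed-point equation $\Phi^\top\theta=\Pi_m T^{(\lambda)}(\Phi^\top\theta)$. Then, with $\beta=\frac{\gamma(1-\lambda)}{1-\lambda\gamma}$, $$\|\Phi^\top\theta^*-V^\pi\|_m\le\frac{1}{1-\sqrt{\beta}}\,\|\Pi_m V^\pi-V^\pi\|_m .$$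
   Context: In $M=(S,A,P,R,\gamma,\rho)$, $S$ is the state space, $A$ the action space, $P$ the transition probabilities, $R$ the reward function, $\gamma$ the discount factor and $\rho$ the initial state distribution. A policy $\pi$ assigns to each state $s$ a probability distribution $\pi(\cdot|s)$ on $A$. The value function is $V^\pi(s)=\mathbb{E}^\pi\big[\sum_{t=0}^\infty\gamma^t R(s_t,a_t)\,\big|\,s_0=s\big]$, where $a_t\sim\pi(\cdot|s_t)$ and $s_{t+1}\sim P(\cdot|s_t,a_t)$. The matrix $P_\pi\in\mathbb{R}^{|S|\times|S|}$, with entries $P_\pi(s'|s)=\sum_a\pi(a|s)P(s'|s,a)$ (row $s$, column $s'$), and the vector $R_\pi\in\mathbb{R}^{|S|}$, with entries $R_\pi(s)=\sum_a\pi(a|s)R(s,a)$, are the (row-stochastic) transition matrix and reward vector induced by $\pi$; $P_\mu$ is defined likewise. The stationary distribution $d_\mu$ is a probability vector with $d_\mu^\top P_\mu=d_\mu^\top$. The behavior policy generates samples by $a_t\sim\mu(\cdot|s_t)$, $s_{t+1}\sim P(\cdot|s_t,a_t)$, and the ratios $\pi(a_t|s_t)/\mu(a_t|s_t)$ are assumed to be well-defined for all $t$. $\mathbb{R}^+$ denotes the nonnegative reals; $i(s)$ signifies the importance of state $s$. Each state $s$ has a feature vector $\phi(s)\in\mathbb{R}^n$, and $\Phi\in\mathbb{R}^{n\times|S|}$ is the matrix whose columns are the feature vectors of all states. The subspace spanned by the features is $\{\Phi^\top\theta:\theta\in\mathbb{R}^n\}\subseteq\mathbb{R}^{|S|}$.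 For $d\in\mathbb{R}^{|S|}$ with $d>0$ element-wise, the $d$-weighted Euclidean norm is $\|v\|_d=\big(\sum_s d(s)v(s)^2\big)^{1/2}$, and $\Pi_d$ is the orthogonal projection onto that subspace with respect to this norm (i.e. $\Pi_d v$ is the minimizer of $\|u-v\|_d$ over $u$ in the subspace). *)

theory Defs
  imports "HOL-Probability.Probability"
begin

section \<open>Markov decision processes and trajectories\<close>

record ('s, 'a) mdp =
  transition :: "'s \<Rightarrow> 'a \<Rightarrow> 's pmf"
  reward :: "'s \<Rightarrow> 'a \<Rightarrow> real"
  disc :: real
  initial :: "'s pmf"

type_synonym ('s, 'a) policy = "'s \<Rightarrow> 'a pmf"

text \<open>
  A trajectory is a function \<^term>\<open>w :: nat \<Rightarrow> 's \<times> 'a\<close> with \<^term>\<open>w t\<close> the pair of the state and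
  the action at time \<^term>\<open>t\<close>. The function \<open>step_kernel M p r t w\<close> is the law of the pair at time
  \<^term>\<open>t\<close> given the history \<^term>\<open>w\<close> before time \<^term>\<open>t\<close>, where \<^term>\<open>r\<close> is the law of the
  state at time 0.
\<close>

definition state_dist ::
    "('s, 'a) mdp \<Rightarrow> 's pmf \<Rightarrow> nat \<Rightarrow> (nat \<Rightarrow> 's \<times> 'a) \<Rightarrow> 's pmf" where
  "state_dist M r t w =
     (case t of 0 \<Rightarrow> r | Suc k \<Rightarrow> transition M (fst (w k)) (snd (w k)))"

definition step_kernel ::
    "('s, 'a) mdp \<Rightarrow> ('s, 'a) policy \<Rightarrow> 's pmf \<Rightarrow> nat \<Rightarrow> (nat \<Rightarrow> 's \<times> 'a) \<Rightarrow> ('s \<times> 'a) measure" where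
  "step_kernel M p r t w =
     measure_pmf (bind_pmf (state_dist M r t w) (\<lambda>s. map_pmf (\<lambda>a. (s, a)) (p s)))"

lemma measurable_step_kernel:
  "step_kernel M p r t \<in>
     measurable (PiM {0..<t} (\<lambda>_. count_space UNIV)) (subprob_algebra (count_space UNIV))"
proof (cases t)
  case 0
  then show ?thesis
    by (auto simp: step_kernel_def[abs_def] state_dist_def space_subprob_algebra
        intro!: measurable_const measure_pmf.subprob_space_axioms)
next
  case (Suc k)
  let ?f = "\<lambda>x. measure_pmf (bind_pmf (transition M (fst x) (snd x)) (\<lambda>s. map_pmf (\<lambda>a. (s, a)) (p s)))"
  have "?f \<in> measurable (count_space UNIV) (subprob_algebra (count_space UNIV))"
    by (auto simp: space_subprob_algebra intro!: measure_pmf.subprob_space_axioms)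
  moreover have "(\<lambda>w. w k) \<in> measurable (PiM {0..<t} (\<lambda>_. count_space UNIV)) (count_space UNIV)"
    using Suc by (intro measurable_component_singleton) auto
  ultimately have "(\<lambda>w. ?f (w k)) \<in>
     measurable (PiM {0..<t} (\<lambda>_. count_space UNIV)) (subprob_algebra (count_space UNIV))"
    by (rule measurable_compose[rotated])
  then show ?thesis
    using Suc by (simp add: step_kernel_def[abs_def] state_dist_def)
qed

lemma Ionescu_Tulcea_step_kernel: "Ionescu_Tulcea (step_kernel M p r) (\<lambda>_. count_space UNIV)"
  unfolding Ionescu_Tulcea_def
  by (simp add: measurable_step_kernel) (simp add: step_kernel_def measure_pmf.prob_space_axioms)

text \<open>The Ionescu-Tulcea extension of the step kernels.\<close>

definition trajectory_measure ::
    "('s, 'a) mdp \<Rightarrow> ('s, 'a) policy \<Rightarrow> 's pmf \<Rightarrow> (nat \<Rightarrow> 's \<times> 'a) measure" where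
  "trajectory_measure M p r =
     projective_family.lim UNIV
       (Ionescu_Tulcea.CI (step_kernel M p r) (\<lambda>_. count_space UNIV)) (\<lambda>_. count_space UNIV)"

definition value_function ::
    "('s::finite, 'a) mdp \<Rightarrow> ('s, 'a) policy \<Rightarrow> real ^ 's" where
  "value_function M p =
     (\<chi> s. LINT w|trajectory_measure M p (return_pmf s).
        (\<Sum>t. disc M ^ t * reward M (fst (w t)) (snd (w t))))"

text \<open>
  The importance sampling ratios are required to be well-defined only at states that the behavior
  policy \<^term>\<open>q\<close> visits with positive probability when started from the initial distribution.
\<close>

definition ratios_well_defined ::
    "('s, 'a) mdp \<Rightarrow> ('s, 'a) policy \<Rightarrow> ('s, 'a) policy \<Rightarrow> bool" where
  "ratios_well_defined M p q \<longleftrightarrow>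
     (AE w in trajectory_measure M q (initial M).
        \<forall>t a. pmf (q (fst (w t))) a = 0 \<longrightarrow> pmf (p (fst (w t))) a = 0)"


section \<open>Induced matrices and vectors\<close>

definition policy_trans :: "('s::finite, 'a) mdp \<Rightarrow> ('s, 'a) policy \<Rightarrow> real ^ 's ^ 's" where
  "policy_trans M p = (\<chi> s s'. \<Sum>\<^sub>\<infinity>a. pmf (p s) a * pmf (transition M s a) s')"

definition policy_reward :: "('s::finite, 'a) mdp \<Rightarrow> ('s, 'a) policy \<Rightarrow> real ^ 's" where
  "policy_reward M p = (\<chi> s. \<Sum>\<^sub>\<infinity>a. pmf (p s) a * reward M s a)"

definition stationary_distribution ::
    "('s::finite, 'a) mdp \<Rightarrow> ('s, 'a) policy \<Rightarrow> real ^ 's \<Rightarrow> bool" where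
  "stationary_distribution M q d \<longleftrightarrow>
     (\<forall>s. 0 \<le> d $ s) \<and> (\<Sum>s\<in>UNIV. d $ s) = 1 \<and> d v* policy_trans M q = d"

definition resolvent :: "('s::finite, 'a) mdp \<Rightarrow> ('s, 'a) policy \<Rightarrow> real \<Rightarrow> real ^ 's ^ 's" where
  "resolvent M p l = matrix_inv (mat 1 - (disc M * l) *\<^sub>R policy_trans M p)"

definition lambda_trans :: "('s::finite, 'a) mdp \<Rightarrow> ('s, 'a) policy \<Rightarrow> real \<Rightarrow> real ^ 's ^ 's" where
  "lambda_trans M p l = mat 1 - resolvent M p l ** (mat 1 - disc M *\<^sub>R policy_trans M p)"

definition bellman_lambda ::
    "('s::finite, 'a) mdp \<Rightarrow> ('s, 'a) policy \<Rightarrow> real \<Rightarrow> real ^ 's \<Rightarrow> real ^ 's" where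
  "bellman_lambda M p l v = resolvent M p l *v policy_reward M p + lambda_trans M p l *v v"

definition emphatic_weights ::
    "('s::finite, 'a) mdp \<Rightarrow> ('s, 'a) policy \<Rightarrow> real \<Rightarrow> ('s \<Rightarrow> real) \<Rightarrow> real ^ 's \<Rightarrow> real ^ 's" where
  "emphatic_weights M p l i d = (\<chi> s. i s * d $ s) v* matrix_inv (mat 1 - lambda_trans M p l)"


section \<open>Features and weighted projection\<close>

definition feature_matrix :: "('s::finite \<Rightarrow> real ^ 'n) \<Rightarrow> real ^ 's ^ 'n" where
  "feature_matrix \<phi> = (\<chi> k s. \<phi> s $ k)"

definition feature_space :: "real ^ 's ^ 'n \<Rightarrow> (real ^ 's::finite) set" where
  "feature_space F = range (\<lambda>\<theta>. transpose F *v \<theta>)"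

definition weighted_norm :: "real ^ 's \<Rightarrow> real ^ 's::finite \<Rightarrow> real" where
  "weighted_norm d v = sqrt (\<Sum>s\<in>UNIV. d $ s * (v $ s)\<^sup>2)"

text \<open>For \<^term>\<open>d\<close> positive in every component the minimizer below exists and is unique.\<close>

definition weighted_proj :: "real ^ 's \<Rightarrow> real ^ 's ^ 'n \<Rightarrow> real ^ 's \<Rightarrow> real ^ 's::finite" where
  "weighted_proj d F v = arg_min_on (\<lambda>u. weighted_norm d (u - v)) (feature_space F)"

end

theory Submission
  imports Defs
begin

text \<open>
  The law of the pair at time \<open>t\<close> gives the reward at time \<open>t\<close> the expectation \<open>P\<^sup>t R\<close>. Summing with
  weights \<open>\<gamma>\<^sup>t\<close> yields \<open>V = R + \<gamma> P V\<close>, which makes \<open>V\<close> a fixed point of \<open>T\<^sup>(\<^sup>\<lambda>\<^sup>)\<close>.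
  The matrix \<open>Q = P\<^sup>\<lambda>\<close> equals \<open>(I - \<gamma>\<lambda>P)\<^sup>-\<^sup>1 \<gamma>(1-\<lambda>)P\<close>, so it is
  nonnegative with row sums \<open>\<beta>\<close>. The emphatic weights satisfy \<open>m - mQ = i d \<ge> 0\<close>; by the
  Cauchy-Schwarz inequality in each row,
  \<open>\<parallel>Q v\<parallel>\<^sup>2 \<le> \<beta> \<Sum>s. (mQ)(s) v(s)\<^sup>2 \<le> \<beta> \<parallel>v\<parallel>\<^sup>2\<close> in the \<open>m\<close>-weighted norm. The projection is
  nonexpansive in this norm, and the bound follows from the triangle inequality through \<open>\<Pi> V\<close>.
\<close>

section \<open>Inverses of I - cP for row-stochastic P and 0 <= c < 1\<close>

lemma matrix_inv_cancel:
  fixes A :: "real ^ 'n ^ 'n"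
  assumes "invertible A"
  shows "A ** matrix_inv A = mat 1" and "matrix_inv A ** A = mat 1"
proof -
  from assms have "A ** matrix_inv A = mat 1 \<and> matrix_inv A ** A = mat 1"
    unfolding invertible_def matrix_inv_def by (rule someI_ex)
  then show "A ** matrix_inv A = mat 1" and "matrix_inv A ** A = mat 1"
    by auto
qed

definition row_stochastic :: "real ^ 's ^ 's::finite \<Rightarrow> bool" where
  "row_stochastic P \<longleftrightarrow> (\<forall>s s'. 0 \<le> P $ s $ s') \<and> (\<forall>s. (\<Sum>s'\<in>UNIV. P $ s $ s') = 1)"

lemma discounted_mult_nth:
  fixes P :: "real ^ 's ^ 's::finite"
  shows "((mat 1 - c *\<^sub>R P) *v x) $ s = x $ s - c * (\<Sum>s'\<in>UNIV. P $ s $ s' * x $ s')"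
  unfolding matrix_vector_mult_diff_rdistrib scaleR_matrix_vector_assoc[symmetric]
    matrix_vector_mul_lid
  by (simp add: matrix_vector_mult_def)

text \<open>Maximum principle: evaluate the hypothesis where \<^term>\<open>x\<close> is minimal.\<close>

lemma discounted_mult_nonneg_imp_nonneg:
  fixes P :: "real ^ 's ^ 's::finite"
  assumes P: "row_stochastic P" and c: "0 \<le> c" "c < 1"
    and x: "\<And>s. 0 \<le> ((mat 1 - c *\<^sub>R P) *v x) $ s"
  shows "0 \<le> x $ s"
proof -
  obtain t where t: "\<And>s. x $ t \<le> x $ s"
    using ex_is_arg_min_if_finite[of UNIV "($) x"] by (auto simp: is_arg_min_linorder)
  have "x $ t = (\<Sum>s'\<in>UNIV. P $ t $ s' * x $ t)"
    using P by (simp add: row_stochastic_def sum_distrib_right[symmetric])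
  also have "\<dots> \<le> (\<Sum>s'\<in>UNIV. P $ t $ s' * x $ s')"
    using P t by (intro sum_mono mult_left_mono) (auto simp: row_stochastic_def)
  finally have "c * x $ t \<le> x $ t"
    using x[of t] mult_left_mono[OF _ c(1)] unfolding discounted_mult_nth by fastforce
  then have "0 \<le> (1 - c) * x $ t"
    by (simp add: algebra_simps)
  with c have "0 \<le> x $ t"
    by (simp add: zero_le_mult_iff)
  with t show ?thesis
    by (meson order_trans)
qed

text \<open>The maximum principle applied to a kernel vector and to its negative forces the vector
  to vanish, and a square matrix with trivial kernel is invertible.\<close>

lemma invertible_discounted:
  fixes P :: "real ^ 's ^ 's::finite"
  assumes P: "row_stochastic P" and c: "0 \<le> c" "c < 1"
  shows "invertible (mat 1 - c *\<^sub>R P)"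
proof -
  have "x = 0" if "(mat 1 - c *\<^sub>R P) *v x = 0" for x
  proof -
    have "(mat 1 - c *\<^sub>R P) *v (- x) = 0"
      using that by (simp add: linear_neg[OF matrix_vector_mul_linear])
    then have "0 \<le> (- x) $ s" "0 \<le> x $ s" for s
      using that discounted_mult_nonneg_imp_nonneg[OF P c, of x s]
        discounted_mult_nonneg_imp_nonneg[OF P c, of "- x" s] by simp_all
    then show ?thesis
      by (simp add: vec_eq_iff order_antisym)
  qed
  then show ?thesis
    using matrix_left_invertible_ker invertible_left_inverse by blast
qed

text \<open>Multiplying the vector by I - cP returns \<open>y\<close>, so the maximum principle
  applies to it.\<close>

lemma discounted_inverse_nonneg:
  fixes P :: "real ^ 's ^ 's::finite"
  assumes P: "row_stochastic P" and c: "0 \<le> c" "c < 1" and y: "\<And>s. 0 \<le> y $ s"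
  shows "0 \<le> (matrix_inv (mat 1 - c *\<^sub>R P) *v y) $ s"
  by (rule discounted_mult_nonneg_imp_nonneg[OF P c])
    (simp add: y matrix_vector_mul_assoc matrix_inv_cancel[OF invertible_discounted[OF P c]])

section \<open>Weighted norms and the weighted projection\<close>

lemma weighted_norm_mult_le:
  fixes Q :: "real ^ 's ^ 's::finite"
  assumes Q: "\<And>s s'. 0 \<le> Q $ s $ s'" and row: "\<And>s. (\<Sum>s'\<in>UNIV. Q $ s $ s') = \<beta>"
    and m: "\<And>s. 0 \<le> m $ s" and mQ: "\<And>s. (m v* Q) $ s \<le> m $ s"
  shows "weighted_norm m (Q *v v) \<le> sqrt \<beta> * weighted_norm m v"
proof -
  have \<beta>: "0 \<le> \<beta>"
    using row Q by (metis sum_nonneg)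
  let ?w = "\<chi> s. (v $ s)\<^sup>2"
  \<comment> \<open>Each product \<open>Q $ s $ s' * v $ s'\<close> is split into
    \<open>sqrt (Q $ s $ s')\<close> and \<open>sqrt (Q $ s $ s') * v $ s'\<close>; the squares of
    the first factors add up to the row sum \<open>\<beta>\<close>.\<close>
  have cs: "((Q *v v) $ s)\<^sup>2 \<le> \<beta> * (Q *v ?w) $ s" for s
    using Cauchy_Schwarz_ineq_sum[of "\<lambda>s'. sqrt (Q $ s $ s')" "\<lambda>s'. sqrt (Q $ s $ s') * v $ s'" UNIV] Q
    by (simp add: matrix_vector_mult_def row power_mult_distrib mult.assoc[symmetric])
  have "(\<Sum>s\<in>UNIV. m $ s * ((Q *v v) $ s)\<^sup>2) \<le> (\<Sum>s\<in>UNIV. m $ s * (\<beta> * (Q *v ?w) $ s))"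
    by (intro sum_mono mult_left_mono cs m)
  also have "\<dots> = \<beta> * inner m (Q *v ?w)"
    by (simp add: inner_vec_def sum_distrib_left mult.left_commute)
  \<comment> \<open>Transposing \<open>Q\<close> onto \<open>m\<close> makes the hypothesis
    \<open>mQ\<close> applicable.\<close>
  also have "\<dots> = \<beta> * (\<Sum>s\<in>UNIV. (m v* Q) $ s * (v $ s)\<^sup>2)"
    unfolding dot_lmul_matrix[symmetric] by (simp add: inner_vec_def)
  also have "\<dots> \<le> \<beta> * (\<Sum>s\<in>UNIV. m $ s * (v $ s)\<^sup>2)"
    by (intro mult_left_mono sum_mono mult_right_mono mQ \<beta>) auto
  finally show ?thesis
    by (simp add: weighted_norm_def flip: real_sqrt_mult)
qed

text \<open>Scaling by square roots turns the weighted norm into the Euclidean one, so that the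
  weighted projection becomes a metric projection.\<close>

definition sqrt_scale :: "real ^ 's \<Rightarrow> real ^ 's \<Rightarrow> real ^ 's::finite" where
  "sqrt_scale m v = (\<chi> s. sqrt (m $ s) * v $ s)"

lemma linear_sqrt_scale: "linear (sqrt_scale m)"
  by (rule linearI) (simp_all add: sqrt_scale_def vec_eq_iff algebra_simps)

lemma weighted_norm_eq_norm:
  assumes "\<And>s. 0 \<le> m $ s"
  shows "weighted_norm m v = norm (sqrt_scale m v)"
  using assms by (simp add: weighted_norm_def sqrt_scale_def norm_vec_def L2_set_def power_mult_distrib)

lemma weighted_norm_triangle:
  assumes "\<And>s. 0 \<le> m $ s"
  shows "weighted_norm m (u + v) \<le> weighted_norm m u + weighted_norm m v"
  by (simp add: weighted_norm_eq_norm[OF assms] linear_add[OF linear_sqrt_scale] norm_triangle_ineq)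

lemma subspace_feature_space: "subspace (feature_space F)"
  unfolding feature_space_def
  by (intro linear_subspace_image subspace_UNIV matrix_vector_mul_linear)

text \<open>\<open>weighted_proj\<close> is a choice among minimizers, so existence comes first: the
  image subspace is closed and has a closest point. Minimizers may differ where \<open>m\<close>
  vanishes, but their scaled images agree, since the closest point of a closed convex set is
  unique.\<close>

lemma sqrt_scale_weighted_proj:
  assumes m: "\<And>s. 0 \<le> m $ s"
  shows "sqrt_scale m (weighted_proj m F v)
    = closest_point (sqrt_scale m ` feature_space F) (sqrt_scale m v)"
proof -
  let ?S = "feature_space F" and ?D = "sqrt_scale m"
  have sub: "subspace (?D ` ?S)"
    by (intro linear_subspace_image linear_sqrt_scale subspace_feature_space)
  have dist: "weighted_norm m (u - v) = dist (?D v) (?D u)" for u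
    by (simp add: weighted_norm_eq_norm[OF m] linear_diff[OF linear_sqrt_scale] dist_norm norm_minus_commute)
  have ne: "?D ` ?S \<noteq> {}"
    using subspace_0[OF subspace_feature_space] by blast
  have "\<exists>u. is_arg_min (\<lambda>u. weighted_norm m (u - v)) (\<lambda>u. u \<in> ?S) u"
    using closest_point_exists[OF closed_subspace[OF sub] ne, of "?D v"]
    unfolding is_arg_min_linorder dist by auto
  then have "is_arg_min (\<lambda>u. weighted_norm m (u - v)) (\<lambda>u. u \<in> ?S) (weighted_proj m F v)"
    unfolding weighted_proj_def arg_min_on_def arg_min_def by (rule someI_ex)
  then show ?thesis
    unfolding is_arg_min_linorder dist
    by (intro closest_point_unique subspace_imp_convex[OF sub] closed_subspace[OF sub]) auto
qed

lemma weighted_proj_nonexpansive: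
  assumes m: "\<And>s. 0 \<le> m $ s"
  shows "weighted_norm m (weighted_proj m F u - weighted_proj m F v) \<le> weighted_norm m (u - v)"
proof -
  let ?S = "sqrt_scale m ` feature_space F"
  have sub: "subspace ?S"
    by (intro linear_subspace_image linear_sqrt_scale subspace_feature_space)
  have "?S \<noteq> {}"
    using subspace_0[OF subspace_feature_space] by blast
  then show ?thesis
    using closest_point_lipschitz[OF subspace_imp_convex[OF sub] closed_subspace[OF sub]]
    by (simp add: weighted_norm_eq_norm[OF m] linear_diff[OF linear_sqrt_scale]
        sqrt_scale_weighted_proj[OF m] dist_norm)
qed

text \<open>Since \<open>T V = V\<close>, both \<open>u\<close> and the projection of
  \<open>V\<close> are projections of values of \<open>T\<close>. Nonexpansiveness and contraction
  bound their distance by \<open>k * weighted_norm m (u - V)\<close>, which is absorbed into the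
  left-hand side because \<open>k < 1\<close>.\<close>

lemma projected_fixed_point_error:
  assumes m: "\<And>s. 0 \<le> m $ s" and k: "k < 1"
    and contr: "\<And>u v. weighted_norm m (T u - T v) \<le> k * weighted_norm m (u - v)"
    and V: "T V = V" and u: "u = weighted_proj m F (T u)"
  shows "weighted_norm m (u - V) \<le> 1 / (1 - k) * weighted_norm m (weighted_proj m F V - V)"
proof -
  have "weighted_norm m (u - V)
      \<le> weighted_norm m (u - weighted_proj m F V) + weighted_norm m (weighted_proj m F V - V)"
    using weighted_norm_triangle[OF m, of "u - weighted_proj m F V" "weighted_proj m F V - V"] by simp
  also have "weighted_norm m (u - weighted_proj m F V) \<le> weighted_norm m (T u - T V)"
    using weighted_proj_nonexpansive[OF m, of F "T u" "T V"] u V by simp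
  also have "\<dots> \<le> k * weighted_norm m (u - V)"
    by (rule contr)
  finally have "(1 - k) * weighted_norm m (u - V) \<le> weighted_norm m (weighted_proj m F V - V)"
    by (simp add: algebra_simps)
  with k show ?thesis
    by (simp add: pos_le_divide_eq mult.commute)
qed

section \<open>Expectations under discrete laws\<close>

lemma expectation_pmf_eq_count_space:
  fixes h :: "'b \<Rightarrow> real"
  shows "measure_pmf.expectation q h = (LINT x|count_space UNIV. pmf q x * h x)"
  unfolding measure_pmf_eq_density by (subst integral_density) simp_all

lemma integrable_pmf_iff_count_space:
  fixes h :: "'b \<Rightarrow> real"
  shows "integrable (measure_pmf q) h \<longleftrightarrow> integrable (count_space UNIV) (\<lambda>x. pmf q x * h x)"
  unfolding measure_pmf_eq_density by (subst integrable_density) simp_all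

lemma pmf_bind_finite:
  fixes q :: "'s::finite pmf"
  shows "pmf (bind_pmf q f) x = (\<Sum>s\<in>UNIV. pmf q s * pmf (f s) x)"
  by (simp add: pmf_bind integral_measure_pmf[of UNIV])

text \<open>In terms of densities against counting measure the mixture is a finite linear
  combination, so linearity of the integral is enough although \<open>h\<close> may be unbounded and
  \<open>'b\<close> infinite.\<close>

lemma
  fixes q :: "'s::finite pmf" and h :: "'b \<Rightarrow> real"
  assumes "\<And>s. integrable (measure_pmf (f s)) h"
  shows integrable_bind_pmf_finite: "integrable (measure_pmf (bind_pmf q f)) h"
    and expectation_bind_pmf_finite: "measure_pmf.expectation (bind_pmf q f) h
      = (\<Sum>s\<in>UNIV. pmf q s * measure_pmf.expectation (f s) h)"
proof -
  have eq: "pmf (bind_pmf q f) x * h x = (\<Sum>s\<in>UNIV. pmf q s * (pmf (f s) x * h x))" for x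
    by (simp add: pmf_bind_finite sum_distrib_right mult.assoc)
  have int: "integrable (count_space UNIV) (\<lambda>x. pmf q s * (pmf (f s) x * h x))" for s
    using assms[of s] by (simp add: integrable_pmf_iff_count_space)
  show "integrable (measure_pmf (bind_pmf q f)) h"
    unfolding integrable_pmf_iff_count_space eq by (intro Bochner_Integration.integrable_sum int)
  show "measure_pmf.expectation (bind_pmf q f) h
      = (\<Sum>s\<in>UNIV. pmf q s * measure_pmf.expectation (f s) h)"
    unfolding expectation_pmf_eq_count_space eq
    by (subst Bochner_Integration.integral_sum[OF int]) simp
qed

text \<open>A real family is summable in the unordered sense exactly when it is absolutely summable,
  that is, integrable against counting measure. This links the \<open>infsum\<close> in
  \<open>policy_reward\<close> and \<open>policy_trans\<close> to expectations.\<close>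

lemma
  fixes h :: "'b \<Rightarrow> real"
  assumes "(\<lambda>x. pmf q x * h x) summable_on UNIV"
  shows integrable_pmf_if_summable_on: "integrable (measure_pmf q) h"
    and infsum_pmf_eq_expectation: "(\<Sum>\<^sub>\<infinity>x. pmf q x * h x) = measure_pmf.expectation q h"
proof -
  have "(\<lambda>x. norm (pmf q x * h x)) summable_on UNIV"
    using assms by (simp only: summable_on_iff_abs_summable_on_real[symmetric])
  then have abs: "Infinite_Set_Sum.abs_summable_on (\<lambda>x. pmf q x * h x) UNIV"
    by (simp add: abs_summable_equivalent[symmetric])
  then show "integrable (measure_pmf q) h"
    by (simp add: integrable_pmf_iff_count_space Infinite_Set_Sum.abs_summable_on_def)
  show "(\<Sum>\<^sub>\<infinity>x. pmf q x * h x) = measure_pmf.expectation q h"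
    using infsetsum_infsum[OF abs]
    by (simp add: expectation_pmf_eq_count_space infsetsum_def)
qed

section \<open>One-time marginals of the trajectory measure\<close>

definition policy_kernel :: "('s, 'a) mdp \<Rightarrow> ('s, 'a) policy \<Rightarrow> 's \<Rightarrow> 's pmf" where
  "policy_kernel M p s = bind_pmf (p s) (transition M s)"

text \<open>The summands are dominated by the weights of \<open>p s\<close>, so the
  \<open>infsum\<close> over a possibly infinite action space is a genuine sum and not a default
  value. Nonnegativity and row sums of \<open>policy_trans\<close> can then be read off from a
  pmf.\<close>

lemma policy_trans_nth: "policy_trans M p $ s $ s' = pmf (policy_kernel M p s) s'"
proof -
  have "integrable (measure_pmf (p s)) (\<lambda>a. pmf (transition M s a) s')"
    by (rule measure_pmf.integrable_const_bound[where B = 1]) (auto simp: pmf_le_1)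
  then have "Infinite_Set_Sum.abs_summable_on (\<lambda>a. pmf (p s) a * pmf (transition M s a) s') UNIV"
    by (simp add: integrable_pmf_iff_count_space Infinite_Set_Sum.abs_summable_on_def)
  then have "(\<lambda>a. pmf (p s) a * pmf (transition M s a) s') summable_on UNIV"
    using abs_summable_equivalent abs_summable_summable by blast
  then show ?thesis
    by (simp add: policy_trans_def policy_kernel_def pmf_bind infsum_pmf_eq_expectation)
qed

primrec state_law :: "('s, 'a) mdp \<Rightarrow> ('s, 'a) policy \<Rightarrow> 's pmf \<Rightarrow> nat \<Rightarrow> 's pmf" where
  "state_law M p r 0 = r"
| "state_law M p r (Suc t) = bind_pmf (state_law M p r t) (policy_kernel M p)"

definition pair_law :: "('s, 'a) mdp \<Rightarrow> ('s, 'a) policy \<Rightarrow> 's pmf \<Rightarrow> nat \<Rightarrow> ('s \<times> 'a) pmf" where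
  "pair_law M p r t = bind_pmf (state_law M p r t) (\<lambda>s. map_pmf (Pair s) (p s))"

text \<open>This puts the recursion into the form of \<open>step_kernel\<close>, where the next
  state is drawn from the previous pair; in \<open>state_law\<close> the action is already averaged
  out.\<close>

lemma pair_law_Suc:
  "pair_law M p r (Suc t) =
    bind_pmf (pair_law M p r t) (\<lambda>x. bind_pmf (transition M (fst x) (snd x)) (\<lambda>s. map_pmf (Pair s) (p s)))"
  by (simp add: pair_law_def policy_kernel_def bind_assoc_pmf bind_map_pmf)

text \<open>Induction on \<open>t\<close> for all \<open>f\<close> at once: integrating out the last
  pair leaves a function of the pair before it, to which the induction hypothesis applies.\<close>

lemma nn_integral_C_eq_pair_law:
  fixes f :: "'s \<times> 'a \<Rightarrow> ennreal"
  shows "(\<integral>\<^sup>+w. f (w t) \<partial>Ionescu_Tulcea.C (step_kernel M p r) (\<lambda>_. count_space UNIV) 0 (Suc t) (\<lambda>_. undefined))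
    = (\<integral>\<^sup>+x. f x \<partial>measure_pmf (pair_law M p r t))"
proof (induction t arbitrary: f)
  interpret IT: Ionescu_Tulcea "step_kernel M p r" "\<lambda>_. count_space UNIV"
    by (rule Ionescu_Tulcea_step_kernel)
  have meas: "(\<lambda>w. g (w t)) \<in> borel_measurable (PiM {0..<Suc t} (\<lambda>_. count_space UNIV))"
    for g :: "'s \<times> 'a \<Rightarrow> ennreal" and t
    by (rule measurable_compose[OF measurable_component_singleton]) auto
  \<comment> \<open>Coordinate \<open>t\<close> is the last of those built by
    \<open>IT.C 0 (Suc t)\<close>, so its kernel can be integrated out by itself.\<close>
  have step: "(\<integral>\<^sup>+w. g (w t) \<partial>IT.C 0 (Suc t) (\<lambda>_. undefined)) =
      (\<integral>\<^sup>+w. \<integral>\<^sup>+x. g x \<partial>step_kernel M p r t w \<partial>IT.C 0 t (\<lambda>_. undefined))" for g t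
  proof -
    have [simp]: "(\<lambda>_. undefined) \<in> space (PiM {0..<0::nat} (\<lambda>_. count_space (UNIV :: ('s \<times> 'a) set)))"
      by simp
    have "(\<integral>\<^sup>+w. g (w t) \<partial>IT.C 0 (Suc t) (\<lambda>_. undefined)) =
      (\<integral>\<^sup>+w. \<integral>\<^sup>+w'. g (w' t) \<partial>IT.eP t w \<partial>IT.C 0 t (\<lambda>_. undefined))"
      unfolding IT.C.simps add_0
    proof (rule nn_integral_bind[OF meas])
      show "IT.eP t \<in> measurable (IT.C 0 t (\<lambda>_. undefined)) (subprob_algebra (PiM {0..<Suc t} (\<lambda>_. count_space UNIV)))"
        using IT.measurable_eP[of t] by (simp add: measurable_cong_sets[OF IT.sets_C refl])
    qed
    also have "\<dots> = (\<integral>\<^sup>+w. \<integral>\<^sup>+x. g x \<partial>step_kernel M p r t w \<partial>IT.C 0 t (\<lambda>_. undefined))"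
      by (intro nn_integral_cong, subst IT.nn_integral_eP[OF _ meas]) (auto simp: IT.space_C)
    finally show ?thesis .
  qed
  {
    case 0
    interpret C: prob_space "IT.C 0 0 (\<lambda>_. undefined)"
      by (rule IT.prob_space_C) simp
    show ?case
      by (subst step) (simp add: C.emeasure_space_1 step_kernel_def state_dist_def pair_law_def del: IT.C.simps)
  next
    case (Suc t)
    \<comment> \<open>\<open>?g y\<close> is the expectation of \<open>f\<close> one step after the
      pair \<open>y\<close>; the kernel at time \<open>Suc t\<close> sees the history only through
      \<open>w t\<close>.\<close>
    let ?g = "\<lambda>y. \<integral>\<^sup>+x. f x \<partial>measure_pmf (bind_pmf (transition M (fst y) (snd y)) (\<lambda>s. map_pmf (Pair s) (p s)))"
    have "(\<integral>\<^sup>+w. f (w (Suc t)) \<partial>IT.C 0 (Suc (Suc t)) (\<lambda>_. undefined))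
      = (\<integral>\<^sup>+w. ?g (w t) \<partial>IT.C 0 (Suc t) (\<lambda>_. undefined))"
      by (subst step) (simp only: step_kernel_def state_dist_def nat.case)
    also have "\<dots> = (\<integral>\<^sup>+x. f x \<partial>measure_pmf (pair_law M p r (Suc t)))"
      unfolding Suc.IH[of ?g] pair_law_Suc by (simp only: nn_integral_bind_pmf)
    finally show ?case .
  }
qed

lemma sets_trajectory_measure:
  "sets (trajectory_measure M p r) = sets (PiM UNIV (\<lambda>_. count_space UNIV))"
proof -
  interpret IT: Ionescu_Tulcea "step_kernel M p r" "\<lambda>_. count_space UNIV"
    by (rule Ionescu_Tulcea_step_kernel)
  show ?thesis
    by (simp add: trajectory_measure_def)
qed

lemma measurable_trajectory_component:
  "(\<lambda>w. w t) \<in> measurable (trajectory_measure M p r) (count_space UNIV)"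
  by (simp add: measurable_cong_sets[OF sets_trajectory_measure refl])

text \<open>Events about coordinate \<open>t\<close> are cylinders over the first
  \<open>t + 1\<close> coordinates, and on these the projective limit agrees with the finite-horizon
  measure \<open>C\<close>.\<close>

lemma distr_trajectory_component:
  "distr (trajectory_measure M p r) (count_space UNIV) (\<lambda>w. w t) = measure_pmf (pair_law M p r t)"
proof (rule measure_eqI)
  interpret IT: Ionescu_Tulcea "step_kernel M p r" "\<lambda>_. count_space UNIV"
    by (rule Ionescu_Tulcea_step_kernel)
  fix A
  let ?N = "\<lambda>J. PiM J (\<lambda>_. count_space UNIV) :: (nat \<Rightarrow> 'a \<times> 'b) measure"
  let ?J = "{0..<Suc t}"
  let ?X = "{w \<in> space (?N ?J). w t \<in> A}"
  have [simp]: "(\<lambda>_. undefined) \<in> space (?N {0..<0})"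
    by simp
  have X: "?X \<in> sets (?N ?J)"
    using measurable_sets[OF measurable_component_singleton[of t ?J "\<lambda>_. count_space UNIV"], of A]
    by (simp add: vimage_def Int_def conj_commute)
  \<comment> \<open>\<open>emeasure_CI\<close> embeds the base set into the coordinates up to the
    chosen horizon; with horizon \<open>Suc t\<close> these are exactly \<open>?J\<close>.\<close>
  have emb: "prod_emb ?J (\<lambda>_. count_space UNIV) ?J ?X = ?X"
    by (rule prod_emb_id) (auto simp: space_PiM)
  have "emeasure (distr (trajectory_measure M p r) (count_space UNIV) (\<lambda>w. w t)) A
      = emeasure IT.PF.lim (prod_emb UNIV (\<lambda>_. count_space UNIV) ?J ?X)"
    by (subst emeasure_distr[OF measurable_trajectory_component])
      (auto simp: trajectory_measure_def prod_emb_def space_PiM intro!: arg_cong2[where f = emeasure])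
  also have "\<dots> = emeasure (IT.C 0 (Suc t) (\<lambda>_. undefined)) ?X"
    using X by (simp add: IT.lim IT.emeasure_CI[of _ "Suc t"] emb del: IT.C.simps)
  also have "\<dots> = (\<integral>\<^sup>+w. indicator A (w t) \<partial>IT.C 0 (Suc t) (\<lambda>_. undefined))"
    using X by (subst nn_integral_indicator[symmetric])
      (auto simp: IT.sets_C IT.space_C intro!: nn_integral_cong split: split_indicator
        simp del: IT.C.simps nn_integral_indicator)
  also have "\<dots> = emeasure (measure_pmf (pair_law M p r t)) A"
    unfolding nn_integral_C_eq_pair_law by simp
  finally show "emeasure (distr (trajectory_measure M p r) (count_space UNIV) (\<lambda>w. w t)) A
      = emeasure (measure_pmf (pair_law M p r t)) A" .
qed simp

text \<open>Both parts are transported to \<open>pair_law\<close> and split by the current state;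
  integrability under each \<open>p s\<close> suffices as there are finitely many states.\<close>

lemma
  fixes M :: "('s::finite, 'a) mdp" and g :: "'s \<times> 'a \<Rightarrow> real"
  assumes "\<And>s. integrable (measure_pmf (p s)) (\<lambda>a. g (s, a))"
  shows integrable_trajectory_component: "integrable (trajectory_measure M p r) (\<lambda>w. g (w t))"
    and expectation_trajectory_component: "(LINT w|trajectory_measure M p r. g (w t))
      = (\<Sum>s\<in>UNIV. pmf (state_law M p r t) s * measure_pmf.expectation (p s) (\<lambda>a. g (s, a)))"
proof -
  have *: "integrable (measure_pmf (map_pmf (Pair s) (p s))) g" for s
    using assms by simp
  have "integrable (measure_pmf (pair_law M p r t)) g"
    unfolding pair_law_def by (intro integrable_bind_pmf_finite *)
  then show "integrable (trajectory_measure M p r) (\<lambda>w. g (w t))"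
    unfolding distr_trajectory_component[symmetric]
    by (subst (asm) integrable_distr_eq[OF measurable_trajectory_component]) auto
  have "(LINT w|trajectory_measure M p r. g (w t)) = measure_pmf.expectation (pair_law M p r t) g"
    unfolding distr_trajectory_component[symmetric]
    by (subst integral_distr[OF measurable_trajectory_component]) auto
  then show "(LINT w|trajectory_measure M p r. g (w t))
      = (\<Sum>s\<in>UNIV. pmf (state_law M p r t) s * measure_pmf.expectation (p s) (\<lambda>a. g (s, a)))"
    unfolding pair_law_def by (subst (asm) expectation_bind_pmf_finite[OF *]) simp
qed

text \<open>\<open>state_law\<close> appends its step at the end, so in the induction that step acts
  on \<open>h\<close>. This is why \<open>h\<close> is generalized and why
  \<open>funpow_swap1\<close> has to commute one factor past the iterate.\<close>

lemma expectation_state_law: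
  fixes M :: "('s::finite, 'a) mdp"
  shows "(\<Sum>s'\<in>UNIV. pmf (state_law M p (return_pmf s) t) s' * h $ s') = (((*v) (policy_trans M p) ^^ t) h) $ s"
proof (induction t arbitrary: h)
  case 0
  show ?case
    by (simp add: indicator_def)
next
  case (Suc t)
  have "(\<Sum>s'\<in>UNIV. pmf (state_law M p (return_pmf s) (Suc t)) s' * h $ s')
      = (\<Sum>s'\<in>UNIV. pmf (state_law M p (return_pmf s) t) s' * (policy_trans M p *v h) $ s')"
    by (simp add: pmf_bind_finite sum_distrib_right sum_distrib_left matrix_vector_mult_def
        policy_trans_nth mult.assoc) (rule sum.swap)
  then show ?case
    by (simp add: Suc.IH funpow_swap1)
qed

section \<open>The value function as a discounted series\<close>

text \<open>By Tonelli the series of norms has finite integral, hence is finite almost everywhere.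
  This supplies a premise for exchanging series and integral in
  \<open>value_function_sums\<close>.\<close>

lemma AE_summable_if_summable_integral_norm:
  fixes f :: "nat \<Rightarrow> 'b \<Rightarrow> real"
  assumes int: "\<And>t. integrable N (f t)" and sum: "summable (\<lambda>t. LINT x|N. norm (f t x))"
  shows "AE x in N. summable (\<lambda>t. norm (f t x))"
proof -
  have [measurable]: "f t \<in> borel_measurable N" for t
    using int by auto
  have "(\<integral>\<^sup>+x. (\<Sum>t. ennreal (norm (f t x))) \<partial>N) = (\<Sum>t. \<integral>\<^sup>+x. ennreal (norm (f t x)) \<partial>N)"
    by (intro nn_integral_suminf) auto
  also have "\<dots> = (\<Sum>t. ennreal (LINT x|N. norm (f t x)))"
    by (intro arg_cong[where f = suminf] ext nn_integral_eq_integral integrable_norm int) auto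
  also have "\<dots> \<noteq> \<infinity>"
    using sum by (simp add: ennreal_suminf_neq_top)
  finally have "AE x in N. (\<Sum>t. ennreal (norm (f t x))) \<noteq> \<infinity>"
    by (intro nn_integral_PInf_AE) auto
  then show ?thesis
    by eventually_elim (auto intro: summable_suminf_not_top)
qed

lemma value_function_sums:
  fixes M :: "('s::finite, 'a) mdp"
  assumes disc: "0 \<le> disc M" "disc M < 1"
    and R: "\<And>s. (\<lambda>a. pmf (p s) a * reward M s a) summable_on UNIV"
  shows "(\<lambda>t. disc M ^ t * (((*v) (policy_trans M p) ^^ t) (policy_reward M p)) $ s)
    sums (value_function M p $ s)"
proof -
  let ?N = "trajectory_measure M p (return_pmf s)"
  let ?f = "\<lambda>t w. disc M ^ t * reward M (fst (w t)) (snd (w t))"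
  \<comment> \<open>Rewards may be unbounded, but state probabilities are at most 1, so this finite
    sum bounds the expected absolute reward at every time and yields a geometric majorant.\<close>
  let ?B = "\<Sum>s\<in>UNIV. measure_pmf.expectation (p s) (\<lambda>a. \<bar>reward M s a\<bar>)"
  have intR: "integrable (measure_pmf (p s)) (reward M s)" for s
    by (rule integrable_pmf_if_summable_on[OF R])
  have intf: "integrable ?N (?f t)" for t
    by (rule integrable_trajectory_component[where g = "\<lambda>x. disc M ^ t * reward M (fst x) (snd x)"])
      (simp add: intR)
  have bound: "(LINT w|?N. norm (?f t w)) \<le> disc M ^ t * ?B" for t
  proof -
    have "(LINT w|?N. norm (?f t w)) = disc M ^ t * (LINT w|?N. \<bar>reward M (fst (w t)) (snd (w t))\<bar>)"
      using disc by (simp add: abs_mult)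
    also have "(LINT w|?N. \<bar>reward M (fst (w t)) (snd (w t))\<bar>) = (\<Sum>s'\<in>UNIV.
        pmf (state_law M p (return_pmf s) t) s' * measure_pmf.expectation (p s') (\<lambda>a. \<bar>reward M s' a\<bar>))"
      by (subst expectation_trajectory_component[where g = "\<lambda>x. \<bar>reward M (fst x) (snd x)\<bar>"])
        (simp_all add: intR)
    also have "disc M ^ t * \<dots> \<le> disc M ^ t * ?B"
      using disc by (intro mult_left_mono sum_mono mult_left_le_one_le) (auto simp: pmf_le_1)
    finally show ?thesis .
  qed
  have sum: "summable (\<lambda>t. LINT w|?N. norm (?f t w))"
    by (rule summable_comparison_test'[where g = "\<lambda>t. disc M ^ t * ?B" and N = 0])
      (use disc bound in \<open>auto intro!: summable_mult2 summable_geometric simp: abs_of_nonneg integral_nonneg_AE\<close>)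
  have "(LINT w|?N. ?f t w) = disc M ^ t * (((*v) (policy_trans M p) ^^ t) (policy_reward M p)) $ s" for t
    using expectation_trajectory_component[where g = "\<lambda>x. reward M (fst x) (snd x)" and p = p
        and M = M and r = "return_pmf s" and t = t]
    by (simp add: intR policy_reward_def infsum_pmf_eq_expectation[OF R] flip: expectation_state_law)
  from this[symmetric] show ?thesis
    using sums_integral[OF intf AE_summable_if_summable_integral_norm[OF intf sum] sum]
    by (simp only: value_function_def vec_lambda_beta)
qed

text \<open>Applying the discounted transition matrix termwise to the series of the value function
  shifts it by one index. Restoring the term at time 0, the expected reward, gives the same series,
  and limits are unique.\<close>

lemma value_function_bellman:
  fixes M :: "('s::finite, 'a) mdp"
  assumes disc: "0 \<le> disc M" "disc M < 1"
    and R: "\<And>s. (\<lambda>a. pmf (p s) a * reward M s a) summable_on UNIV"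
  shows "value_function M p = policy_reward M p + disc M *\<^sub>R (policy_trans M p *v value_function M p)"
proof -
  let ?P = "policy_trans M p" and ?R = "policy_reward M p" and ?V = "value_function M p"
  let ?x = "\<lambda>t. ((*v) ?P ^^ t) ?R"
  note sums = value_function_sums[OF disc R]
  have "?V $ s = (?R + disc M *\<^sub>R (?P *v ?V)) $ s" for s
  proof -
    have "(\<lambda>t. disc M * (\<Sum>s'\<in>UNIV. ?P $ s $ s' * (disc M ^ t * ?x t $ s')))
        sums (disc M * (\<Sum>s'\<in>UNIV. ?P $ s $ s' * ?V $ s'))"
      by (intro sums_mult sums_sum sums)
    also have "(\<lambda>t. disc M * (\<Sum>s'\<in>UNIV. ?P $ s $ s' * (disc M ^ t * ?x t $ s')))
        = (\<lambda>t. disc M ^ Suc t * ?x (Suc t) $ s)"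
      by (simp add: matrix_vector_mult_def sum_distrib_left mult_ac)
    finally have "(\<lambda>t. disc M ^ t * ?x t $ s) sums (disc M * (\<Sum>s'\<in>UNIV. ?P $ s $ s' * ?V $ s') + ?R $ s)"
      by (subst (asm) sums_Suc_iff) simp
    with sums have "?V $ s = disc M * (\<Sum>s'\<in>UNIV. ?P $ s $ s' * ?V $ s') + ?R $ s"
      by (rule sums_unique2)
    also have "\<dots> = (?R + disc M *\<^sub>R (?P *v ?V)) $ s"
      by (simp add: matrix_vector_mult_def)
    finally show ?thesis .
  qed
  then show ?thesis
    unfolding vec_eq_iff by blast
qed

section \<open>The matrix \<open>lambda_trans\<close> and the emphatic weights\<close>

lemma row_stochastic_policy_trans: "row_stochastic (policy_trans M p)"
  by (simp add: row_stochastic_def policy_trans_nth sum_pmf_eq_1)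

context
  fixes M :: "('s::finite, 'a) mdp" and p :: "('s, 'a) policy" and l :: real
  assumes disc: "0 \<le> disc M" "disc M < 1" and l: "0 \<le> l" "l < 1"
begin

lemma disc_mult_lambda: "0 \<le> disc M * l" "disc M * l < 1"
  using disc l mult_left_le[of l "disc M"] by auto

lemma invertible_resolvent_inverse: "invertible (mat 1 - (disc M * l) *\<^sub>R policy_trans M p)"
  by (rule invertible_discounted[OF row_stochastic_policy_trans disc_mult_lambda])

lemma resolvent_cancel:
  "resolvent M p l ** (mat 1 - (disc M * l) *\<^sub>R policy_trans M p) = mat 1"
  "(mat 1 - (disc M * l) *\<^sub>R policy_trans M p) ** resolvent M p l = mat 1"
  unfolding resolvent_def by (rule matrix_inv_cancel[OF invertible_resolvent_inverse])+

text \<open>Unlike the defining difference, this is a product of nonnegative matrices, from which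
  signs and row sums can be read off.\<close>

lemma lambda_trans_eq:
  "lambda_trans M p l = resolvent M p l ** ((disc M * (1 - l)) *\<^sub>R policy_trans M p)"
proof -
  let ?P = "policy_trans M p"
  have "mat 1 - (disc M * l) *\<^sub>R ?P = (disc M * (1 - l)) *\<^sub>R ?P + (mat 1 - disc M *\<^sub>R ?P)"
    by (simp add: algebra_simps)
  then have "mat 1 = resolvent M p l ** ((disc M * (1 - l)) *\<^sub>R ?P)
      + resolvent M p l ** (mat 1 - disc M *\<^sub>R ?P)"
    using resolvent_cancel(1) by (simp only: matrix_add_ldistrib)
  then show ?thesis
    unfolding lambda_trans_def diff_eq_eq .
qed

text \<open>Each column is the resolvent applied to a nonnegative vector.\<close>

lemma lambda_trans_nonneg: "0 \<le> lambda_trans M p l $ s $ s'"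
proof -
  let ?B = "(disc M * (1 - l)) *\<^sub>R policy_trans M p"
  have "lambda_trans M p l $ s $ s' = (resolvent M p l *v column s' ?B) $ s"
    by (simp add: lambda_trans_eq matrix_matrix_mult_def matrix_vector_mult_def column_def)
  also have "\<dots> \<ge> 0"
    unfolding resolvent_def
    by (rule discounted_inverse_nonneg[OF row_stochastic_policy_trans disc_mult_lambda])
      (use disc l in \<open>simp add: column_def policy_trans_nth\<close>)
  finally show ?thesis .
qed

text \<open>The all-ones vector is fixed by the transition matrix, hence is an eigenvector of the
  resolvent with eigenvalue \<open>1 / (1 - disc M * l)\<close>.\<close>

lemma lambda_trans_row_sum:
  "(\<Sum>s'\<in>UNIV. lambda_trans M p l $ s $ s') = disc M * (1 - l) / (1 - l * disc M)"
proof -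
  let ?one = "1 :: real ^ 's"
  have P: "policy_trans M p *v ?one = ?one"
    using row_stochastic_policy_trans[of M p]
    by (simp add: vec_eq_iff matrix_vector_mult_def row_stochastic_def)
  have "(mat 1 - (disc M * l) *\<^sub>R policy_trans M p) *v ?one = (1 - disc M * l) *\<^sub>R ?one"
    unfolding matrix_vector_mult_diff_rdistrib scaleR_matrix_vector_assoc[symmetric] P
      matrix_vector_mul_lid by (simp add: vec_eq_iff)
  then have "?one = (1 - disc M * l) *\<^sub>R (resolvent M p l *v ?one)"
    using resolvent_cancel(1)
    by (metis matrix_vector_mul_assoc matrix_vector_mul_lid matrix_vector_mult_scaleR)
  then have "(1 - disc M * l) * (resolvent M p l *v ?one) $ s = 1"
    by (metis one_index vector_scaleR_component real_scaleR_def)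
  then have res: "(resolvent M p l *v ?one) $ s = 1 / (1 - disc M * l)"
    using disc_mult_lambda by (simp add: field_simps)
  have "(\<Sum>s'\<in>UNIV. lambda_trans M p l $ s $ s') = (lambda_trans M p l *v ?one) $ s"
    by (simp add: matrix_vector_mult_def)
  also have "\<dots> = disc M * (1 - l) * (resolvent M p l *v ?one) $ s"
    by (simp only: lambda_trans_eq matrix_vector_mul_assoc[symmetric] scaleR_matrix_vector_assoc[symmetric]
        P matrix_vector_mult_scaleR vector_scaleR_component real_scaleR_def)
  finally show ?thesis
    by (simp add: res mult.commute)
qed

lemma emphatic_weights_lambda_trans_le:
  assumes "\<And>s. 0 \<le> i s" "\<And>s. 0 \<le> d $ s"
  shows "(emphatic_weights M p l i d v* lambda_trans M p l) $ s \<le> emphatic_weights M p l i d $ s"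
proof -
  let ?m = "emphatic_weights M p l i d" and ?Q = "lambda_trans M p l"
  \<comment> \<open>Both factors are invertible, so the \<open>matrix_inv\<close> in
    \<open>emphatic_weights\<close> is a true inverse and can be cancelled.\<close>
  have "mat 1 - ?Q = resolvent M p l ** (mat 1 - disc M *\<^sub>R policy_trans M p)"
    by (simp add: lambda_trans_def)
  moreover have "invertible (resolvent M p l)"
    using resolvent_cancel unfolding invertible_def by blast
  ultimately have "invertible (mat 1 - ?Q)"
    using invertible_mult invertible_discounted[OF row_stochastic_policy_trans disc] by metis
  then have "?m v* (mat 1 - ?Q) = (\<chi> s. i s * d $ s)"
    by (simp add: emphatic_weights_def vector_matrix_mul_assoc matrix_inv_cancel)
  moreover have "(?m v* (mat 1 - ?Q)) $ s = ?m $ s - (?m v* ?Q) $ s"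
    unfolding vector_matrix_mult_diff_rdistrib vector_matrix_mul_rid vector_minus_component ..
  ultimately show ?thesis
    using mult_nonneg_nonneg[OF assms(1)[of s] assms(2)[of s]] by simp
qed

text \<open>By the Bellman equation the reward vector is I - \<gamma>P applied to the value
  function, so the resolvent term of the operator cancels the one inside
  \<open>lambda_trans\<close>.\<close>

lemma bellman_lambda_value_function:
  assumes "\<And>s. (\<lambda>a. pmf (p s) a * reward M s a) summable_on UNIV"
  shows "bellman_lambda M p l (value_function M p) = value_function M p"
proof -
  let ?V = "value_function M p" and ?P = "policy_trans M p"
  have "(mat 1 - disc M *\<^sub>R ?P) *v ?V = ?V - disc M *\<^sub>R (?P *v ?V)"
    by (simp only: matrix_vector_mult_diff_rdistrib scaleR_matrix_vector_assoc matrix_vector_mul_lid)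
  also have "\<dots> = policy_reward M p"
    using value_function_bellman[OF disc assms] by (simp add: algebra_simps)
  finally show ?thesis
    by (simp add: bellman_lambda_def lambda_trans_def matrix_vector_mult_diff_rdistrib
        flip: matrix_vector_mul_assoc)
qed

end

section \<open>The error bound for the projected fixed point\<close>

theorem corollary2:
  fixes M :: "('s::finite, 'a) mdp"
    and \<pi> \<mu> :: "('s, 'a) policy"
    and \<gamma> lam \<beta> :: real
    and d m :: "real ^ 's"
    and i :: "'s \<Rightarrow> real"
    and \<phi> :: "'s \<Rightarrow> real ^ 'n"
    and \<Phi> :: "real ^ 's ^ 'n"
    and \<theta> :: "real ^ 'n"
  assumes "\<gamma> = disc M" and "0 \<le> \<gamma>" and "\<gamma> < 1"
    and "0 \<le> lam" and "lam < 1"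
    and "\<And>s. (\<lambda>a. pmf (\<pi> s) a * reward M s a) summable_on UNIV"
    and "ratios_well_defined M \<pi> \<mu>"
    and "stationary_distribution M \<mu> d"
    and "\<And>s. 0 \<le> i s"
    and "m = emphatic_weights M \<pi> lam i d" and "\<And>s. 0 < m $ s"
    and "\<Phi> = feature_matrix \<phi>"
    and "transpose \<Phi> *v \<theta> =
           weighted_proj m \<Phi> (bellman_lambda M \<pi> lam (transpose \<Phi> *v \<theta>))"
    and "\<beta> = \<gamma> * (1 - lam) / (1 - lam * \<gamma>)"
  shows "weighted_norm m (transpose \<Phi> *v \<theta> - value_function M \<pi>)
         \<le> 1 / (1 - sqrt \<beta>) * weighted_norm m (weighted_proj m \<Phi> (value_function M \<pi>) - value_function M \<pi>)"
proof -
  note disc = assms(2,3)[unfolded assms(1)]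
  have m: "0 \<le> m $ s" for s
    using assms(11)[of s] by simp
  have d: "0 \<le> d $ s" for s
    using assms(8) by (simp add: stationary_distribution_def)
  have row: "(\<Sum>s'\<in>UNIV. lambda_trans M \<pi> lam $ s $ s') = \<beta>" for s
    using lambda_trans_row_sum[OF disc assms(4,5)] by (simp add: assms(1,14))
  have "lam * \<gamma> < 1"
    using disc_mult_lambda[OF disc assms(4,5)] by (simp add: assms(1) mult.commute)
  \<comment> \<open>After clearing the positive denominator, \<open>\<beta> < 1\<close> reduces to
    \<open>\<gamma> < 1\<close>.\<close>
  then have "sqrt \<beta> < 1"
    using assms(3) by (simp add: assms(14) algebra_simps)
  \<comment> \<open>The reward term cancels in the difference, leaving \<open>lambda_trans\<close>
    applied to \<open>u - v\<close>.\<close>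
  moreover have "weighted_norm m (bellman_lambda M \<pi> lam u - bellman_lambda M \<pi> lam v)
      \<le> sqrt \<beta> * weighted_norm m (u - v)" for u v
    using weighted_norm_mult_le[OF lambda_trans_nonneg[OF disc assms(4,5)] row m, of "u - v"]
      emphatic_weights_lambda_trans_le[OF disc assms(4,5,9) d] assms(10)
    by (simp add: bellman_lambda_def matrix_vector_mult_diff_distrib)
  ultimately show ?thesis
    by (rule projected_fixed_point_error[OF m])
      (rule bellman_lambda_value_function[OF disc assms(4-6)], rule assms(13))
qed

end
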